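(* Suppose that: (A) $r_0(t;w)\ge0$ for all $t\ge t_0$, $w\in(-\infty;+\infty)$; (B) for each $t\ge t_0$ the functions $p_0(t;w)$, $\frac{q_0(t;w)}{p_0(t;w)}$ and $-r_0(t;w)$ are nonincreasing in $w$ on $(-\infty;0]$ and nondecreasing in $w$ on $[0;+\infty)$. Then for all $\phi_{(0)},\phi_{(1)}\in\mathbb{R}$ the solution $\phi_0(t)$ of the equation $$(p_0(t;\phi(t))\phi'(t))'+q_0(t;\phi(t))\phi'(t)+r_0(t;\phi(t))\phi(t)=0,\qquad t\ge t_0,$$ satisfying the initial conditions $\phi_0(t_0)=\phi_{(0)}$, $\phi_0'(t_0)=\phi_{(1)}$, exists on $[t_0;+\infty)$.
   Context: Fix $t_0\in\mathbb{R}$. The functions $p_0(t;w),q_0(t;w),r_0(t;w)$ are real valued and continuous on $[t_0;+\infty)\times(-\infty;+\infty)$, with $p_0(t;w)>0$ everywhere. A solution of the equation on an interval is a continuously differentiable function $\phi$ such that $p_0(t;\phi(t))\phi'(t)$ is continuously differentiable and the equation holds. Local solutions always exist (Peano) but need not be unique; "the solution with given initial conditions exists on $[t_0;+\infty)$" means that any solution with these initial conditions which is not extendable to the right is defined on all of $[t_0;+\infty)$. *)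

theory Defs
  imports "HOL-Analysis.Analysis"
begin

text \<open>
  A partial function on an interval \<open>I\<close> is represented by a total function \<open>\<phi>\<close> together with \<open>I\<close>;
  only the values of \<open>\<phi>\<close> on \<open>I\<close> matter. Derivatives are taken within \<open>I\<close>, so they are one-sided at
  an end point belonging to \<open>I\<close>. For this to determine derivatives, \<open>I\<close> must not be a single point.

  In \<open>solution_on\<close>, \<open>\<phi>'\<close> is the derivative of \<open>\<phi>\<close> and \<open>\<psi>'\<close> that of \<open>p(t;\<phi>)\<phi>'\<close>.
\<close>

definition solution_on ::
  "real \<Rightarrow> (real \<Rightarrow> real \<Rightarrow> real) \<Rightarrow> (real \<Rightarrow> real \<Rightarrow> real) \<Rightarrow> (real \<Rightarrow> real \<Rightarrow> real)
    \<Rightarrow> real set \<Rightarrow> (real \<Rightarrow> real) \<Rightarrow> bool" where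
  "solution_on t0 p q r I \<phi> \<longleftrightarrow>
     is_interval I \<and> I \<subseteq> {t0..} \<and> (\<exists>a\<in>I. \<exists>b\<in>I. a < b) \<and>
     (\<exists>\<phi>' \<psi>'.
        (\<forall>t\<in>I. (\<phi> has_real_derivative \<phi>' t) (at t within I)) \<and>
        continuous_on I \<phi>' \<and>
        (\<forall>t\<in>I. ((\<lambda>s. p s (\<phi> s) * \<phi>' s) has_real_derivative \<psi>' t) (at t within I)) \<and>
        continuous_on I \<psi>' \<and>
        (\<forall>t\<in>I. \<psi>' t + q t (\<phi> t) * \<phi>' t + r t (\<phi> t) * \<phi> t = 0))"

definition ivp_solution_on ::
  "real \<Rightarrow> (real \<Rightarrow> real \<Rightarrow> real) \<Rightarrow> (real \<Rightarrow> real \<Rightarrow> real) \<Rightarrow> (real \<Rightarrow> real \<Rightarrow> real)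
    \<Rightarrow> real \<Rightarrow> real \<Rightarrow> real set \<Rightarrow> (real \<Rightarrow> real) \<Rightarrow> bool" where
  "ivp_solution_on t0 p q r c0 c1 I \<phi> \<longleftrightarrow>
     solution_on t0 p q r I \<phi> \<and> t0 \<in> I \<and>
     \<phi> t0 = c0 \<and> (\<phi> has_real_derivative c1) (at t0 within I)"

definition right_extendable ::
  "real \<Rightarrow> (real \<Rightarrow> real \<Rightarrow> real) \<Rightarrow> (real \<Rightarrow> real \<Rightarrow> real) \<Rightarrow> (real \<Rightarrow> real \<Rightarrow> real)
    \<Rightarrow> real set \<Rightarrow> (real \<Rightarrow> real) \<Rightarrow> bool" where
  "right_extendable t0 p q r I \<phi> \<longleftrightarrow>
     (\<exists>J \<eta>. solution_on t0 p q r J \<eta> \<and> I \<subseteq> J \<and> (\<exists>t\<in>J. \<forall>s\<in>I. s < t) \<and>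
            (\<forall>s\<in>I. \<eta> s = \<phi> s))"

text \<open>
  Solutions need not be unique: ``the solution with given initial data exists on \<open>[t0;+\<infinity>)\<close>'' means
  that every solution with these data that is not extendable to the right is defined on all of
  \<open>[t0;+\<infinity>)\<close>.
\<close>

definition ivp_solution_exists_globally ::
  "real \<Rightarrow> (real \<Rightarrow> real \<Rightarrow> real) \<Rightarrow> (real \<Rightarrow> real \<Rightarrow> real) \<Rightarrow> (real \<Rightarrow> real \<Rightarrow> real)
    \<Rightarrow> real \<Rightarrow> real \<Rightarrow> bool" where
  "ivp_solution_exists_globally t0 p q r c0 c1 \<longleftrightarrow>
     (\<forall>I \<phi>. ivp_solution_on t0 p q r c0 c1 I \<phi> \<longrightarrow> \<not> right_extendable t0 p q r I \<phi> \<longrightarrow> I = {t0..})"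

end

theory Submission
  imports Defs "HOL-Complex_Analysis.Great_Picard"
begin

text \<open>
  With \<open>v = p(t;\<phi>)\<phi>'\<close> the equation becomes a continuous first-order system for \<open>(\<phi>, v)\<close>. By
  monotonicity, \<open>1 / p(t;w)\<close> is at most \<open>1 / p(t;0)\<close>, \<open>q(t;w) / p(t;w)\<close> is at least
  \<open>q(t;0) / p(t;0)\<close>, and \<open>0 \<le> r(t;w) \<le> r(t;0)\<close>; on a bounded time interval these bounds are uniform,
  so the energy \<open>\<phi>\<^sup>2 + v\<^sup>2\<close> grows at most exponentially. A solution on a bounded half-open interval
  therefore extends to its end point, and from there to the right by Peano's theorem, which is
  obtained from delayed equations and the Arzela-Ascoli theorem.
\<close>

section \<open>Peano's existence theorem\<close>

lemma norm_diff_le_of_vector_derivative_le: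
  fixes x :: "real \<Rightarrow> 'a::real_normed_vector"
  assumes "convex S"
    and "\<And>t. t \<in> S \<Longrightarrow> (x has_vector_derivative x' t) (at t within S)"
    and "\<And>t. t \<in> S \<Longrightarrow> norm (x' t) \<le> M"
    and "s \<in> S" "t \<in> S"
  shows "norm (x s - x t) \<le> M * \<bar>s - t\<bar>"
proof -
  have "norm (x s - x t) \<le> M * norm (s - t)"
  proof (rule differentiable_bound[OF assms(1)])
    show "(x has_derivative (\<lambda>h. h *\<^sub>R x' t)) (at t within S)" if "t \<in> S" for t
      using assms(2)[OF that] by (simp add: has_vector_derivative_def)
    show "onorm (\<lambda>h. h *\<^sub>R x' t) \<le> M" if "t \<in> S" for t
      using assms(3)[OF that] by (intro onorm_le) (simp add: mult.commute[of M] mult_left_mono)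
  qed (use assms in auto)
  then show ?thesis
    by simp
qed

text \<open>The Picard iterates of a delayed equation become stationary after finitely many steps, since
  the \<open>n\<close>-th iterate determines the next one exactly on \<open>{..a + n * \<delta>}\<close>.\<close>

lemma delayed_integral_equation:
  fixes f :: "real \<Rightarrow> 'a::euclidean_space \<Rightarrow> 'a"
  assumes f: "continuous_on UNIV (\<lambda>(t, x). f t x)" and "\<delta> > 0" "a \<le> b"
  obtains x where "continuous_on {..b} x"
    and "\<And>t. t \<le> b \<Longrightarrow> x t = x0 + integral {a..t} (\<lambda>s. f s (x (s - \<delta>)))"
proof -
  \<comment> \<open>For \<open>t < a\<close> the domain of integration is empty and the integral is
    0, so \<open>A x\<close> equals \<open>x0\<close> there: the constant history of the delayed
    equation is built into the operator.\<close>
  define A where "A x t = x0 + integral {a..t} (\<lambda>s. f s (x (s - \<delta>)))" for x t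
  define X where "X n = (A ^^ n) (\<lambda>_. x0)" for n :: nat
  have X_Suc: "X (Suc n) = A (X n)" for n
    by (simp add: X_def)
  have cont_A: "continuous_on {..b} (A x)" if x: "continuous_on {..b} x" for x
  proof -
    have "continuous_on {a..b} (\<lambda>s. x (s - \<delta>))"
      by (rule continuous_on_compose2[OF x]) (use \<open>\<delta> > 0\<close> in \<open>auto intro!: continuous_intros\<close>)
    then have "continuous_on {a..b} (\<lambda>s. (\<lambda>(t, x). f t x) (s, x (s - \<delta>)))"
      by (intro continuous_on_compose2[OF f] continuous_intros) auto
    then have "continuous_on {a..b} (\<lambda>t. integral {a..t} (\<lambda>s. f s (x (s - \<delta>))))"
      by (intro indefinite_integral_continuous_1 integrable_continuous_real) simp
    \<comment> \<open>Composing with \<open>max a t\<close> carries continuity from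
      \<open>{a..b}\<close> over to \<open>{..b}\<close>; the clamp does not change the value, since
      for \<open>t < a\<close> both integrals vanish.\<close>
    then have "continuous_on {..b} (\<lambda>t. integral {a..max a t} (\<lambda>s. f s (x (s - \<delta>))))"
      by (rule continuous_on_compose2) (use \<open>a \<le> b\<close> in \<open>auto intro!: continuous_intros\<close>)
    moreover have "integral {a..max a t} g = integral {a..t} g" for t and g :: "real \<Rightarrow> 'a"
      by (cases "t < a") (auto simp: max_def)
    ultimately show ?thesis
      unfolding A_def by (intro continuous_intros) simp
  qed
  have cont: "continuous_on {..b} (X n)" for n
    by (induction n) (simp_all add: X_Suc cont_A, simp add: X_def)
  have stable: "X (Suc n) t = X n t" if "t \<le> a + real n * \<delta>" for n t
    using that
  proof (induction n arbitrary: t)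
    case 0
    then show ?case
      by (cases "t = a") (auto simp: X_Suc A_def, auto simp: X_def)
  next
    case (Suc n)
    \<comment> \<open>For \<open>s \<le> t\<close> the delayed argument \<open>s - \<delta>\<close>
      is at most \<open>a + n * \<delta>\<close>, where the two iterates agree by the induction
      hypothesis.\<close>
    have "integral {a..t} (\<lambda>s. f s (X (Suc n) (s - \<delta>))) = integral {a..t} (\<lambda>s. f s (X n (s - \<delta>)))"
      using Suc by (intro Henstock_Kurzweil_Integration.integral_cong) (auto simp: algebra_simps)
    then show ?case
      by (subst (1 2) X_Suc) (simp add: A_def)
  qed
  \<comment> \<open>Now \<open>a + n * \<delta>\<close> lies beyond \<open>b\<close>, so the
    \<open>n\<close>-th iterate is a fixed point of \<open>A\<close> on all of
    \<open>{..b}\<close>.\<close>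
  obtain n :: nat where "b - a < n * \<delta>"
    using reals_Archimedean3[OF \<open>\<delta> > 0\<close>] by blast
  show ?thesis
  proof (rule that[OF cont])
    show "X n t = x0 + integral {a..t} (\<lambda>s. f s (X n (s - \<delta>)))" if "t \<le> b" for t
      using stable[of t n] that \<open>b - a < n * \<delta>\<close> by (simp add: X_Suc A_def)
  qed
qed

text \<open>The bound \<open>M\<close> makes the solutions of the delayed equations Lipschitz with a
  common constant. Arzela-Ascoli yields a uniformly convergent subsequence as the delay tends to 0,
  and its limit satisfies the undelayed integral equation.\<close>

lemma Peano_existence_bounded:
  fixes f :: "real \<Rightarrow> 'a::euclidean_space \<Rightarrow> 'a"
  assumes f: "continuous_on UNIV (\<lambda>(t, x). f t x)" and M: "\<And>t x. norm (f t x) \<le> M" and "a \<le> b"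
  obtains x where "x a = x0"
    and "\<And>t. t \<in> {a..b} \<Longrightarrow> (x has_vector_derivative f t (x t)) (at t within {a..b})"
proof -
  define \<delta> where "\<delta> n = inverse (real (Suc n))" for n
  have \<delta>: "\<delta> n > 0" for n
    by (simp add: \<delta>_def)
  have \<delta>_lim: "\<delta> \<longlonglongrightarrow> 0"
    unfolding \<delta>_def by (rule LIMSEQ_inverse_real_of_nat)
  have "M \<ge> 0"
    using M[of 0 0] norm_ge_zero order_trans by blast
  have "\<exists>x. continuous_on {..b} x \<and>
      (\<forall>t\<le>b. x t = x0 + integral {a..t} (\<lambda>s. f s (x (s - \<delta> n))))" for n
    using delayed_integral_equation[OF f \<delta> \<open>a \<le> b\<close>] by metis
  then obtain X where X_cont: "\<And>n. continuous_on {..b} (X n)"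
    and X_eq: "\<And>n t. t \<le> b \<Longrightarrow> X n t = x0 + integral {a..t} (\<lambda>s. f s (X n (s - \<delta> n)))"
    by metis
  have F_cont: "continuous_on {a..b} (\<lambda>s. f s (X n (s - \<delta> n)))" for n
  proof -
    have "continuous_on {a..b} (\<lambda>s. X n (s - \<delta> n))"
      by (rule continuous_on_compose2[OF X_cont])
        (use \<delta>[of n] in \<open>auto intro!: continuous_intros\<close>)
    then have "continuous_on {a..b} (\<lambda>s. (\<lambda>(t, x). f t x) (s, X n (s - \<delta> n)))"
      by (intro continuous_on_compose2[OF f] continuous_intros) auto
    then show ?thesis
      by simp
  qed
  have X_a: "X n t = x0" if "t \<le> a" for n t
    using that X_eq[of t n] \<open>a \<le> b\<close> by (cases "t = a") auto
  have lip': "norm (X n t - X n s) \<le> M * \<bar>t - s\<bar>" if "t \<in> {a..b}" "s \<in> {a..b}" for n t s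
  proof (rule norm_diff_le_of_vector_derivative_le[OF _ _ _ that])
    fix t assume t: "t \<in> {a..b}"
    have "((\<lambda>t. x0 + integral {a..t} (\<lambda>s. f s (X n (s - \<delta> n)))) has_vector_derivative
        f t (X n (t - \<delta> n))) (at t within {a..b})"
      using integral_has_vector_derivative[OF F_cont t] by (simp add: has_vector_derivative_add_const add.commute[of x0])
    then show "(X n has_vector_derivative f t (X n (t - \<delta> n))) (at t within {a..b})"
      by (rule has_vector_derivative_transform[rotated 2]) (use t X_eq in auto)
  qed (use M in auto)
  \<comment> \<open>Delayed arguments may lie left of \<open>a\<close>, where \<open>X n\<close> is
    constant; clamping times to \<open>max a t\<close> does not increase distances, so the constant
    \<open>M\<close> survives on \<open>{..b}\<close>.\<close>
  have lip: "norm (X n t - X n s) \<le> M * \<bar>t - s\<bar>" if "t \<le> b" "s \<le> b" for n t s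
  proof -
    have "X n t = X n (max a t)" for t
      using X_a[of t] X_a[of a] by (simp add: max_def)
    then have "norm (X n t - X n s) = norm (X n (max a t) - X n (max a s))"
      by metis
    also have "\<dots> \<le> M * \<bar>max a t - max a s\<bar>"
      using that \<open>a \<le> b\<close> by (intro lip') auto
    also have "\<dots> \<le> M * \<bar>t - s\<bar>"
      using \<open>M \<ge> 0\<close> by (intro mult_left_mono) auto
    finally show ?thesis .
  qed
  obtain g k where g_cont: "continuous_on {a..b} g" and k: "strict_mono (k :: nat \<Rightarrow> nat)"
    and unif: "\<And>e. 0 < e \<Longrightarrow> \<exists>N. \<forall>n t. n \<ge> N \<and> t \<in> {a..b} \<longrightarrow> norm (X (k n) t - g t) < e"
  proof (rule Arzela_Ascoli[of "{a..b}" X "norm x0 + M * (b - a)"])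
    fix n t assume t: "t \<in> {a..b}"
    have "norm (X n t) \<le> norm (X n a) + norm (X n t - X n a)"
      by (metis add.commute diff_add_cancel norm_triangle_ineq)
    also have "norm (X n t - X n a) \<le> M * \<bar>t - a\<bar>"
      using t by (intro lip) auto
    also have "M * \<bar>t - a\<bar> \<le> M * (b - a)"
      using t \<open>M \<ge> 0\<close> by (intro mult_left_mono) auto
    finally show "norm (X n t) \<le> norm x0 + M * (b - a)"
      using X_a by simp
  next
    fix t e :: real assume t: "t \<in> {a..b}" and e: "0 < e"
    \<comment> \<open>Dividing by \<open>M + 1\<close> keeps the radius positive even when
      \<open>M = 0\<close>; the radius does not depend on \<open>n\<close>, which is
      equicontinuity.\<close>
    have "norm (X n t - X n s) < e" if "s \<in> {a..b}" "norm (t - s) < e / (M + 1)" for n s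
    proof -
      have "norm (X n t - X n s) \<le> M * \<bar>t - s\<bar>"
        using t that by (intro lip) auto
      also have "\<dots> \<le> (M + 1) * \<bar>t - s\<bar>"
        by (intro mult_right_mono) auto
      also have "\<dots> < e"
        using that \<open>M \<ge> 0\<close> by (simp add: pos_less_divide_eq mult.commute)
      finally show ?thesis .
    qed
    then show "\<exists>d>0. \<forall>n s. s \<in> {a..b} \<and> norm (t - s) < d \<longrightarrow> norm (X n t - X n s) < e"
      using e \<open>M \<ge> 0\<close> by (intro exI[of _ "e / (M + 1)"]) auto
  qed auto
  have lim: "(\<lambda>n. X (k n) t) \<longlonglongrightarrow> g t" if "t \<in> {a..b}" for t
    unfolding LIMSEQ_iff using unif that by meson
  \<comment> \<open>The delay changes the value by at most \<open>M * \<delta> (k n)\<close>, which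
    tends to 0, so the delayed values have the same limit.\<close>
  have lim': "(\<lambda>n. X (k n) (t - \<delta> (k n))) \<longlonglongrightarrow> g t" if t: "t \<in> {a..b}" for t
  proof -
    have "(\<lambda>n. X (k n) (t - \<delta> (k n)) - X (k n) t) \<longlonglongrightarrow> 0"
    proof (rule tendsto_0_le)
      show "(\<lambda>n. \<delta> (k n)) \<longlonglongrightarrow> 0"
        using LIMSEQ_subseq_LIMSEQ[OF \<delta>_lim k] by (simp add: o_def)
      have "norm (X (k n) (t - \<delta> (k n)) - X (k n) t) \<le> M * \<bar>t - \<delta> (k n) - t\<bar>" for n
        using t \<delta>[of "k n"] by (intro lip) auto
      then show "\<forall>\<^sub>F n in sequentially.
          norm (X (k n) (t - \<delta> (k n)) - X (k n) t) \<le> norm (\<delta> (k n)) * M"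
        by (simp add: mult.commute)
    qed
    from tendsto_add[OF this lim[OF t]] show ?thesis
      by simp
  qed
  have g_eq: "g t = x0 + integral {a..t} (\<lambda>s. f s (g s))" if t: "t \<in> {a..b}" for t
  proof -
    have "(\<lambda>n. integral {a..t} (\<lambda>s. f s (X (k n) (s - \<delta> (k n)))))
        \<longlonglongrightarrow> integral {a..t} (\<lambda>s. f s (g s))"
    \<comment> \<open>The constant \<open>M\<close> dominates all integrands, and continuity of
      \<open>f\<close> gives their pointwise convergence.\<close>
    proof (rule dominated_convergence(2)[where h = "\<lambda>_. M"])
      show "(\<lambda>s. f s (X (k n) (s - \<delta> (k n)))) integrable_on {a..t}" for n
        using t by (intro integrable_continuous_real continuous_on_subset[OF F_cont]) auto
      show "(\<lambda>n. f s (X (k n) (s - \<delta> (k n)))) \<longlonglongrightarrow> f s (g s)" if s: "s \<in> {a..t}" for s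
      proof -
        have "isCont (\<lambda>(t, x). f t x) (s, g s)"
          using f by (simp add: continuous_on_eq_continuous_at)
        from isCont_tendsto_compose[OF this tendsto_Pair[OF tendsto_const lim']] s t
        show ?thesis
          by auto
      qed
    qed (use M in auto)
    then have "(\<lambda>n. X (k n) t) \<longlonglongrightarrow> x0 + integral {a..t} (\<lambda>s. f s (g s))"
      using t by (subst X_eq) (auto intro!: tendsto_intros)
    with lim[OF t] show ?thesis
      by (rule LIMSEQ_unique)
  qed
  have "continuous_on {a..b} (\<lambda>s. (\<lambda>(t, x). f t x) (s, g s))"
    by (intro continuous_on_compose2[OF f] continuous_intros g_cont) auto
  then have fg_cont: "continuous_on {a..b} (\<lambda>s. f s (g s))"
    by simp
  show ?thesis
  proof (rule that)
    show "g a = x0"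
      using g_eq[of a] \<open>a \<le> b\<close> by simp
    fix t assume t: "t \<in> {a..b}"
    have "((\<lambda>t. x0 + integral {a..t} (\<lambda>s. f s (g s))) has_vector_derivative f t (g t))
        (at t within {a..b})"
      using integral_has_vector_derivative[OF fg_cont t] by (simp add: has_vector_derivative_add_const add.commute[of x0])
    then show "(g has_vector_derivative f t (g t)) (at t within {a..b})"
      by (rule has_vector_derivative_transform[rotated 2]) (use t g_eq in auto)
  qed
qed

text \<open>Truncating the right-hand side to the unit ball around the initial value makes it bounded,
  and the solution of the truncated problem does not leave that ball immediately.\<close>

lemma Peano_existence_local:
  fixes f :: "real \<Rightarrow> 'a::euclidean_space \<Rightarrow> 'a"
  assumes f: "continuous_on ({a..b} \<times> UNIV) (\<lambda>(t, x). f t x)" and "a < b"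
  obtains c x where "a < c" "c \<le> b" "x a = x0"
    and "\<And>t. t \<in> {a..c} \<Longrightarrow> (x has_vector_derivative f t (x t)) (at t within {a..c})"
proof -
  define B where "B = cball x0 (1::real)"
  have B: "convex B" "closed B" "B \<noteq> {}"
    by (auto simp: B_def)
  \<comment> \<open>\<open>P\<close> is a continuous retraction of the whole space onto the compact
    set \<open>{a..b} \<times> B\<close>, so \<open>f\<close> composed with \<open>P\<close> is
    continuous everywhere and bounded.\<close>
  define P where "P = (\<lambda>(t, x). (max a (min b t), closest_point B x))"
  have P_cont: "continuous_on UNIV P"
    unfolding P_def case_prod_beta
    by (intro continuous_intros continuous_on_compose2[OF continuous_on_closest_point[OF B]]) auto
  have P_in: "P z \<in> {a..b} \<times> B" for z
    using \<open>a < b\<close> closest_point_in_set[OF B(2,3)] by (cases z) (auto simp: P_def)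
  define g where "g t x = (\<lambda>(t, x). f t x) (P (t, x))" for t x
  have "continuous_on UNIV (\<lambda>z. (\<lambda>(t, x). f t x) (P z))"
    by (rule continuous_on_compose2[OF f P_cont]) (use P_in in \<open>simp add: image_subset_iff mem_Times_iff\<close>)
  then have g_cont: "continuous_on UNIV (\<lambda>(t, x). g t x)"
    by (simp add: g_def case_prod_beta)
  have "compact ((\<lambda>(t, x). f t x) ` ({a..b} \<times> B))"
    by (intro compact_continuous_image continuous_on_subset[OF f] compact_Times)
      (auto simp: B_def)
  then obtain M where M: "\<And>z. z \<in> {a..b} \<times> B \<Longrightarrow> norm ((\<lambda>(t, x). f t x) z) \<le> M"
    by (metis compact_imp_bounded bounded_iff imageI)
  have g_le: "norm (g t x) \<le> M" for t x
    unfolding g_def by (rule M[OF P_in])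
  have "M \<ge> 0"
    using g_le[of 0 0] norm_ge_zero order_trans by blast
  obtain x where x: "x a = x0"
    "\<And>t. t \<in> {a..b} \<Longrightarrow> (x has_vector_derivative g t (x t)) (at t within {a..b})"
    using Peano_existence_bounded[OF g_cont g_le less_imp_le[OF \<open>a < b\<close>]] by blast
  \<comment> \<open>At speed at most \<open>M\<close>, the distance covered in time
    \<open>1 / (M + 1)\<close> is below 1, the radius of \<open>B\<close>; adding 1 avoids division
    by 0.\<close>
  define c where "c = min b (a + 1 / (M + 1))"
  have c: "a < c" "c \<le> b"
    using \<open>a < b\<close> \<open>M \<ge> 0\<close> by (auto simp: c_def)
  have in_B: "x t \<in> B" if "t \<in> {a..c}" for t
  proof -
    have "norm (x t - x a) \<le> M * \<bar>t - a\<bar>"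
      using x(2) g_le c that by (intro norm_diff_le_of_vector_derivative_le[of "{a..b}"]) auto
    also have "\<dots> \<le> M * (1 / (M + 1))"
      using that \<open>M \<ge> 0\<close> by (intro mult_left_mono) (auto simp: c_def)
    also have "\<dots> \<le> 1"
      using \<open>M \<ge> 0\<close> by simp
    finally show ?thesis
      using x(1) by (simp add: B_def dist_norm norm_minus_commute)
  qed
  show ?thesis
  proof (rule that[of c x])
    fix t assume t: "t \<in> {a..c}"
    have "(x has_vector_derivative g t (x t)) (at t within {a..c})"
      by (rule has_vector_derivative_within_subset[OF x(2)]) (use t c in auto)
    moreover have "g t (x t) = f t (x t)"
      using t c closest_point_self[OF in_B[OF t]] by (simp add: g_def P_def)
    ultimately show "(x has_vector_derivative f t (x t)) (at t within {a..c})"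
      by simp
  qed (use c x(1) in auto)
qed

section \<open>Continuation to an end point and gluing\<close>

text \<open>Boundedness confines the graph to a compact set, where \<open>f\<close> is bounded;
  hence \<open>x\<close> is Lipschitz and has a limit at \<open>b\<close>. The integral equation
  then holds up to \<open>b\<close> and gives the one-sided derivative there.\<close>

lemma bounded_solution_extends_to_closed_interval:
  fixes f :: "real \<Rightarrow> 'a::euclidean_space \<Rightarrow> 'a"
  assumes f: "continuous_on ({a..b} \<times> UNIV) (\<lambda>(t, x). f t x)" and "a < b"
    and x: "\<And>t. t \<in> {a..<b} \<Longrightarrow> (x has_vector_derivative f t (x t)) (at t within {a..<b})"
    and bdd: "bounded (x ` {a..<b})"
  obtains y where "\<And>t. t \<in> {a..<b} \<Longrightarrow> y t = x t"
    and "\<And>t. t \<in> {a..b} \<Longrightarrow> (y has_vector_derivative f t (y t)) (at t within {a..b})"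
proof -
  obtain R where R: "\<And>t. t \<in> {a..<b} \<Longrightarrow> norm (x t) \<le> R"
    by (metis bdd bounded_iff imageI)
  have "compact ((\<lambda>(t, x). f t x) ` ({a..b} \<times> cball 0 R))"
    by (intro compact_continuous_image continuous_on_subset[OF f] compact_Times) auto
  then obtain M where M: "\<And>z. z \<in> {a..b} \<times> cball 0 R \<Longrightarrow> norm ((\<lambda>(t, x). f t x) z) \<le> M"
    by (metis compact_imp_bounded bounded_iff imageI)
  have M': "norm (f t (x t)) \<le> M" if "t \<in> {a..<b}" for t
    using M[of "(t, x t)"] R that by simp
  have "M \<ge> 0"
    using order_trans[OF norm_ge_zero M'[of a]] \<open>a < b\<close> by simp
  have "M-lipschitz_on {a..<b} x"
    by (rule lipschitz_onI) (use norm_diff_le_of_vector_derivative_le[OF _ x M'] \<open>M \<ge> 0\<close> in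
      \<open>auto simp: dist_norm\<close>)
  then have "uniformly_continuous_on {a..<b} x"
    by (rule lipschitz_on_uniformly_continuous)
  then obtain y where "uniformly_continuous_on (closure {a..<b}) y"
    and y_eq: "\<And>t. t \<in> {a..<b} \<Longrightarrow> x t = y t"
    by (rule uniformly_continuous_on_extension_on_closure) blast
  then have y_cont: "continuous_on {a..b} y"
    using \<open>a < b\<close> by (simp add: uniformly_continuous_imp_continuous)
  have "continuous_on {a..b} (\<lambda>s. (\<lambda>(t, x). f t x) (s, y s))"
    by (intro continuous_on_compose2[OF f] continuous_intros y_cont) auto
  then have fy_cont: "continuous_on {a..b} (\<lambda>s. f s (y s))"
    by simp
  \<comment> \<open>\<open>G\<close> is an antiderivative of \<open>f\<close> along
    \<open>y\<close>, including at \<open>b\<close>. On \<open>{a..<b}\<close> the difference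
    \<open>x - G\<close> has derivative 0 and is constant; continuity carries this over to
    \<open>y - G\<close> at \<open>b\<close>.\<close>
  define G where "G t = integral {a..t} (\<lambda>s. f s (y s))" for t
  have G: "(G has_vector_derivative f t (y t)) (at t within {a..b})" if "t \<in> {a..b}" for t
    unfolding G_def using integral_has_vector_derivative[OF fy_cont that] .
  have "((\<lambda>t. x t - G t) has_vector_derivative 0) (at t within {a..<b})" if t: "t \<in> {a..<b}" for t
  proof -
    have "(G has_vector_derivative f t (x t)) (at t within {a..<b})"
      by (rule has_vector_derivative_within_subset[of _ _ _ "{a..b}"]) (use G[of t] t y_eq in auto)
    from has_vector_derivative_diff[OF x[OF t] this] show ?thesis
      by simp
  qed
  then obtain k where k: "\<And>t. t \<in> {a..<b} \<Longrightarrow> x t - G t = k"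
    using has_vector_derivative_zero_constant[of "{a..<b}" "\<lambda>t. x t - G t"] by auto
  have "y t = k + G t" if "t \<in> {a..b}" for t
  proof -
    have "continuous_on {a..b} G"
      by (rule continuous_on_vector_derivative[OF G])
    with y_cont have "continuous_on {a..b} (\<lambda>t. y t - G t)"
      by (rule continuous_on_diff)
    then have "continuous_on (closure {a..<b}) (\<lambda>t. y t - G t)"
      using \<open>a < b\<close> by simp
    then have "y t - G t = k"
      by (rule continuous_constant_on_closure) (use k y_eq \<open>a < b\<close> that in simp_all)
    then show ?thesis
      by (simp add: algebra_simps)
  qed
  then have "(y has_vector_derivative f t (y t)) (at t within {a..b})" if t: "t \<in> {a..b}" for t
    by (rule has_vector_derivative_transform[OF t])
      (use G[OF t] in \<open>auto simp: has_vector_derivative_add_const add.commute[of k]\<close>)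
  then show ?thesis
    using that y_eq by metis
qed

text \<open>The one-sided derivatives at \<open>b\<close> agree automatically: both are the value of
  \<open>f\<close> at the common state \<open>x b = y b\<close>.\<close>

lemma solution_concat:
  fixes f :: "real \<Rightarrow> 'a::real_normed_vector \<Rightarrow> 'a"
  assumes "a \<le> b" "b \<le> c"
    and x: "\<And>t. t \<in> {a..b} \<Longrightarrow> (x has_vector_derivative f t (x t)) (at t within {a..b})"
    and y: "\<And>t. t \<in> {b..c} \<Longrightarrow> (y has_vector_derivative f t (y t)) (at t within {b..c})"
    and "x b = y b" and t: "t \<in> {a..c}"
  shows "((\<lambda>t. if t \<in> {a..b} then x t else y t) has_vector_derivative
      f t (if t \<in> {a..b} then x t else y t)) (at t within {a..c})"
proof -
  \<comment> \<open>The gluing rule works on each piece enlarged by the common points of the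
    closures; the only such point is \<open>b\<close>, which lies in both pieces already.\<close>
  have S: "{a..b} \<union> (closure {a..b} \<inter> closure {b..c}) = {a..b}"
    "{b..c} \<union> (closure {a..b} \<inter> closure {b..c}) = {b..c}"
    using assms(1,2) by auto
  have "((\<lambda>t. if t \<in> {a..b} then x t else y t) has_vector_derivative
      (if t \<in> {a..b} then f t (x t) else f t (y t))) (at t within {a..c})"
    by (rule has_vector_derivative_If_within_closures[where T = "{b..c}"], unfold S)
      (use assms in auto)
  then show ?thesis
    by (simp only: if_distrib[of "f t"])
qed

section \<open>Equivalence with a first-order system\<close>

text \<open>The state is \<open>\<phi>\<close> together with the flux
  \<open>v = p(t;\<phi>)\<phi>'\<close> rather than \<open>\<phi>'\<close>: the flux is what the
  equation differentiates, so no derivative of \<open>p\<close> appears.\<close>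

definition first_order_rhs ::
  "(real \<Rightarrow> real \<Rightarrow> real) \<Rightarrow> (real \<Rightarrow> real \<Rightarrow> real) \<Rightarrow> (real \<Rightarrow> real \<Rightarrow> real)
    \<Rightarrow> real \<Rightarrow> real \<times> real \<Rightarrow> real \<times> real" where
  "first_order_rhs p q r t = (\<lambda>(u, v). (v / p t u, - (q t u * (v / p t u)) - r t u * u))"

lemma continuous_on_first_order_rhs:
  assumes "continuous_on (T \<times> UNIV) (\<lambda>(t, w). p t w)"
    and "continuous_on (T \<times> UNIV) (\<lambda>(t, w). q t w)"
    and "continuous_on (T \<times> UNIV) (\<lambda>(t, w). r t w)"
    and p: "\<And>t w. t \<in> T \<Longrightarrow> p t w > 0"
  shows "continuous_on (T \<times> UNIV) (\<lambda>(t, z). first_order_rhs p q r t z)"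
proof -
  have comp: "continuous_on (T \<times> UNIV) (\<lambda>z. g (fst z) (fst (snd z)))"
    if "continuous_on (T \<times> UNIV) (\<lambda>(t, w). g t w)" for g :: "real \<Rightarrow> real \<Rightarrow> real"
  proof -
    have "continuous_on (T \<times> UNIV) (\<lambda>z. (\<lambda>(t, w). g t w) (fst z, fst (snd z)))"
      by (rule continuous_on_compose2[OF that]) (auto intro!: continuous_intros)
    then show ?thesis
      by simp
  qed
  show ?thesis
    unfolding first_order_rhs_def case_prod_beta
    by (intro continuous_intros comp assms) (use p in \<open>auto simp: less_imp_neq[THEN not_sym]\<close>)
qed

lemma solution_on_imp_first_order:
  assumes "solution_on t0 p q r I \<phi>" and p: "\<And>t w. t \<ge> t0 \<Longrightarrow> p t w > 0"
  obtains z where "\<And>t. t \<in> I \<Longrightarrow> fst (z t) = \<phi> t"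
    and "\<And>t. t \<in> I \<Longrightarrow> (z has_vector_derivative first_order_rhs p q r t (z t)) (at t within I)"
proof -
  obtain \<phi>' \<psi>' where
    \<phi>': "\<And>t. t \<in> I \<Longrightarrow> (\<phi> has_real_derivative \<phi>' t) (at t within I)" and
    \<psi>': "\<And>t. t \<in> I \<Longrightarrow>
      ((\<lambda>s. p s (\<phi> s) * \<phi>' s) has_real_derivative \<psi>' t) (at t within I)" and
    eq: "\<And>t. t \<in> I \<Longrightarrow> \<psi>' t + q t (\<phi> t) * \<phi>' t + r t (\<phi> t) * \<phi> t = 0" and
    I: "I \<subseteq> {t0..}"
    using assms(1) unfolding solution_on_def by blast
  define z where "z t = (\<phi> t, p t (\<phi> t) * \<phi>' t)" for t
  show ?thesis
  proof (rule that)
    fix t assume t: "t \<in> I"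
    show "fst (z t) = \<phi> t"
      by (simp add: z_def)
    have "p t (\<phi> t) \<noteq> 0"
      using p[of t "\<phi> t"] t I by auto
    moreover have "\<psi>' t = - (q t (\<phi> t) * \<phi>' t) - r t (\<phi> t) * \<phi> t"
      using eq[OF t] by linarith
    ultimately have "first_order_rhs p q r t (z t) = (\<phi>' t, \<psi>' t)"
      by (simp add: first_order_rhs_def z_def)
    then show "(z has_vector_derivative first_order_rhs p q r t (z t)) (at t within I)"
      using has_vector_derivative_Pair[OF \<phi>'[OF t, unfolded has_real_derivative_iff_has_vector_derivative]
          \<psi>'[OF t, unfolded has_real_derivative_iff_has_vector_derivative]]
      by (simp add: z_def[abs_def])
  qed
qed

text \<open>The continuity required of \<open>\<phi>'\<close> and of the derivative of the flux
  comes for free: both are components of the continuous right-hand side along the continuous curve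
  \<open>z\<close>.\<close>

lemma first_order_imp_solution_on:
  assumes I: "is_interval I" "I \<subseteq> {t0..}" "\<exists>a\<in>I. \<exists>b\<in>I. a < b"
    and rhs: "continuous_on ({t0..} \<times> UNIV) (\<lambda>(t, z). first_order_rhs p q r t z)"
    and p: "\<And>t w. t \<ge> t0 \<Longrightarrow> p t w > 0"
    and z: "\<And>t. t \<in> I \<Longrightarrow> (z has_vector_derivative first_order_rhs p q r t (z t)) (at t within I)"
  shows "solution_on t0 p q r I (\<lambda>t. fst (z t))"
proof -
  define F where "F t = first_order_rhs p q r t (z t)" for t
  have z_cont: "continuous_on I z"
    by (rule continuous_on_vector_derivative[OF z])
  have "continuous_on I (\<lambda>t. (\<lambda>(t, z). first_order_rhs p q r t z) (t, z t))"
    by (intro continuous_on_compose2[OF rhs] continuous_intros z_cont) (use I in auto)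
  then have F_cont: "continuous_on I F"
    by (simp add: F_def[abs_def])
  have fst_z: "((\<lambda>t. fst (z t)) has_real_derivative fst (F t)) (at t within I)" if "t \<in> I" for t
    using bounded_linear.has_vector_derivative[OF bounded_linear_fst z[OF that]]
    by (simp add: F_def has_real_derivative_iff_has_vector_derivative)
  have snd_z: "((\<lambda>t. snd (z t)) has_real_derivative snd (F t)) (at t within I)" if "t \<in> I" for t
    using bounded_linear.has_vector_derivative[OF bounded_linear_snd z[OF that]]
    by (simp add: F_def has_real_derivative_iff_has_vector_derivative)
  have F_eq: "p t (fst (z t)) * fst (F t) = snd (z t)"
    "snd (F t) + q t (fst (z t)) * fst (F t) + r t (fst (z t)) * fst (z t) = 0" if "t \<in> I" for t
  proof -
    have "p t (fst (z t)) \<noteq> 0"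
      using p[of t "fst (z t)"] that I by auto
    then show "p t (fst (z t)) * fst (F t) = snd (z t)"
      "snd (F t) + q t (fst (z t)) * fst (F t) + r t (fst (z t)) * fst (z t) = 0"
      by (simp_all add: F_def first_order_rhs_def case_prod_beta)
  qed
  have cont: "continuous_on I (\<lambda>t. fst (F t))" "continuous_on I (\<lambda>t. snd (F t))"
    by (intro continuous_intros F_cont)+
  have flux: "((\<lambda>s. p s (fst (z s)) * fst (F s)) has_real_derivative snd (F t)) (at t within I)"
    if "t \<in> I" for t
    using snd_z[OF that] by (rule has_field_derivative_transform_within[OF _ zero_less_one that])
      (simp add: F_eq)
  show ?thesis
    unfolding solution_on_def
    by (intro conjI I, rule exI[of _ "\<lambda>t. fst (F t)"], rule exI[of _ "\<lambda>t. snd (F t)"],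
      intro conjI ballI fst_z flux cont F_eq(2))
qed

section \<open>Energy estimate\<close>

text \<open>The damping coefficient \<open>q / p\<close> need only be bounded below: a large positive damping decreases
  the energy \<open>u\<^sup>2 + v\<^sup>2\<close>.\<close>

lemma first_order_solution_bounded:
  assumes p: "\<And>t w. t \<in> {a..<b} \<Longrightarrow> 0 < p t w" "\<And>t w. t \<in> {a..<b} \<Longrightarrow> 1 / p t w \<le> P"
    and q: "\<And>t w. t \<in> {a..<b} \<Longrightarrow> - Q \<le> q t w / p t w"
    and r: "\<And>t w. t \<in> {a..<b} \<Longrightarrow> \<bar>r t w\<bar> \<le> R" and "Q \<ge> 0"
    and z: "\<And>t. t \<in> {a..<b} \<Longrightarrow>
      (z has_vector_derivative first_order_rhs p q r t (z t)) (at t within {a..<b})"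
  shows "bounded (z ` {a..<b})"
proof -
  \<comment> \<open>\<open>P\<close> accounts for the cross term \<open>2 * u * v / p\<close>,
    \<open>R\<close> for the term with \<open>r\<close>, and \<open>2 * Q\<close> for the damping,
    which enters the derivative of the energy as \<open>- 2 * (q / p) * v\<^sup>2\<close>.\<close>
  define C where "C = P + 2 * Q + R"
  define E where "E t = (fst (z t))\<^sup>2 + (snd (z t))\<^sup>2" for t
  define E' where "E' t = 2 * fst (z t) * fst (first_order_rhs p q r t (z t)) +
    2 * snd (z t) * snd (first_order_rhs p q r t (z t))" for t
  have E_deriv: "(E has_real_derivative E' t) (at t within {a..<b})" if "t \<in> {a..<b}" for t
  proof -
    have "((\<lambda>t. fst (z t)) has_real_derivative fst (first_order_rhs p q r t (z t)))
        (at t within {a..<b})"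
      "((\<lambda>t. snd (z t)) has_real_derivative snd (first_order_rhs p q r t (z t)))
        (at t within {a..<b})"
      using bounded_linear.has_vector_derivative[OF bounded_linear_fst z[OF that]]
        bounded_linear.has_vector_derivative[OF bounded_linear_snd z[OF that]]
      by (simp_all add: has_real_derivative_iff_has_vector_derivative)
    then show ?thesis
      unfolding E_def E'_def by (auto intro!: derivative_eq_intros)
  qed
  have E'_le: "E' t \<le> C * E t" if t: "t \<in> {a..<b}" for t
  proof -
    obtain u v where uv: "z t = (u, v)"
      by (cases "z t")
    have mixed: "2 * (u * v) \<le> u\<^sup>2 + v\<^sup>2" "- (2 * (u * v)) \<le> u\<^sup>2 + v\<^sup>2"
      using sum_squares_bound[of u v] sum_squares_bound[of u "- v"] by auto
    have "2 * (u * v) * (1 / p t u) \<le> (u\<^sup>2 + v\<^sup>2) * (1 / p t u)"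
      using mixed p(1)[OF t, of u] by (intro mult_right_mono) auto
    also have "\<dots> \<le> (u\<^sup>2 + v\<^sup>2) * P"
      using p(2)[OF t] by (intro mult_left_mono) auto
    finally have 1: "2 * (u * v) * (1 / p t u) \<le> (u\<^sup>2 + v\<^sup>2) * P" .
    have "- (q t u / p t u) * (2 * v\<^sup>2) \<le> Q * (2 * v\<^sup>2)"
      using q[OF t, of u] by (intro mult_right_mono) auto
    also have "\<dots> \<le> Q * (2 * (u\<^sup>2 + v\<^sup>2))"
      using \<open>Q \<ge> 0\<close> by (intro mult_left_mono) auto
    finally have 2: "- (q t u / p t u) * (2 * v\<^sup>2) \<le> Q * (2 * (u\<^sup>2 + v\<^sup>2))" .
    have "- r t u * (2 * (u * v)) \<le> \<bar>r t u\<bar> * \<bar>2 * (u * v)\<bar>"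
      by (metis abs_ge_self abs_minus_cancel abs_mult)
    also have "\<dots> \<le> R * (u\<^sup>2 + v\<^sup>2)"
      using r[OF t, of u] mixed by (intro mult_mono) auto
    finally have 3: "- r t u * (2 * (u * v)) \<le> R * (u\<^sup>2 + v\<^sup>2)" .
    have "E' t = 2 * (u * v) * (1 / p t u) + - (q t u / p t u) * (2 * v\<^sup>2) + - r t u * (2 * (u * v))"
      by (simp add: E'_def uv first_order_rhs_def algebra_simps power2_eq_square)
    with 1 2 3 show ?thesis
      by (simp add: E_def uv C_def algebra_simps)
  qed
  \<comment> \<open>Gronwall's inequality through an integrating factor: the product of
    \<open>E\<close> and \<open>exp (- C * (t - a))\<close> has nonpositive derivative.\<close>
  have E_le: "E t * exp (- C * (t - a)) \<le> E a" if t: "t \<in> {a..<b}" for t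
  proof -
    have "E t * exp (- C * (t - a)) \<le> E a * exp (- C * (a - a))"
    proof (rule DERIV_nonpos_imp_decreasing_open[of a t "\<lambda>t. E t * exp (- C * (t - a))"])
      fix s assume s: "a < s" "s < t"
      have "(E has_real_derivative E' s) (at s within {a<..<b})"
        by (rule has_field_derivative_subset[OF E_deriv]) (use s t in auto)
      then have "(E has_real_derivative E' s) (at s)"
        using s t by (subst (asm) at_within_open) auto
      then have "((\<lambda>t. E t * exp (- C * (t - a))) has_real_derivative
          (E' s - C * E s) * exp (- C * (s - a))) (at s)"
        by (auto intro!: derivative_eq_intros simp: algebra_simps)
      moreover have "(E' s - C * E s) * exp (- C * (s - a)) \<le> 0"
        using E'_le[of s] s t by (intro mult_nonpos_nonneg) auto
      ultimately show "\<exists>y. ((\<lambda>t. E t * exp (- C * (t - a))) has_real_derivative y) (at s) \<and> y \<le> 0"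
        by blast
    next
      have "continuous_on {a..<b} E"
        using E_deriv by (intro DERIV_continuous_on)
      then have "continuous_on {a..t} E"
        by (rule continuous_on_subset) (use t in auto)
      then show "continuous_on {a..t} (\<lambda>t. E t * exp (- C * (t - a)))"
        by (intro continuous_intros)
    qed (use t in auto)
    then show ?thesis
      by simp
  qed
  \<comment> \<open>\<open>\<bar>C\<bar> * (b - a)\<close> dominates \<open>C * (t - a)\<close>
    whatever the sign of \<open>C\<close>, which makes the bound uniform in
    \<open>t\<close>.\<close>
  have "norm (z t) \<le> sqrt (E a * exp (\<bar>C\<bar> * (b - a)))" if t: "t \<in> {a..<b}" for t
  proof -
    have "E t = E t * exp (- C * (t - a)) * exp (C * (t - a))"
      by (simp add: mult.assoc flip: exp_add)
    also have "\<dots> \<le> E a * exp (C * (t - a))"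
      using E_le[OF t] by (intro mult_right_mono) auto
    also have "C * (t - a) \<le> \<bar>C\<bar> * (b - a)"
      using t by (intro mult_mono) auto
    then have "E a * exp (C * (t - a)) \<le> E a * exp (\<bar>C\<bar> * (b - a))"
      by (intro mult_left_mono) (auto simp: E_def)
    finally show ?thesis
      by (simp add: norm_prod_def E_def)
  qed
  then show ?thesis
    unfolding bounded_iff by blast
qed

section \<open>Compactness bounds, shapes of intervals, minima at zero\<close>

lemma continuous_on_Icc_bounded:
  fixes g :: "real \<Rightarrow> real"
  assumes "continuous_on {a..b} g"
  obtains B where "B \<ge> 0" "\<And>t. t \<in> {a..b} \<Longrightarrow> \<bar>g t\<bar> \<le> B"
proof -
  have "bounded (g ` {a..b})"
    using assms by (intro compact_imp_bounded compact_continuous_image) auto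
  then obtain B where "B > 0" "\<forall>y\<in>g ` {a..b}. norm y \<le> B"
    unfolding bounded_pos by blast
  then show ?thesis
    by (intro that[of B]) auto
qed

text \<open>An interval bounded above is determined by its supremum and by whether it contains it.
  The last two shapes are those that maximality of a solution must rule out.\<close>

lemma is_interval_cases_left_closed:
  fixes I :: "real set"
  assumes "is_interval I" "a \<in> I" "I \<subseteq> {a..}"
  obtains "I = {a..}" | b where "I = {a..b}" "a \<le> b" | b where "I = {a..<b}" "a < b"
proof (cases "bdd_above I")
  case True
  have below: "t \<in> I" if "a \<le> t" "t < Sup I" for t
    using less_cSup_iff[of I t] assms True that unfolding is_interval_1
    by (metis empty_iff less_imp_le)
  have above: "t \<le> Sup I" if "t \<in> I" for t
    using cSup_upper[OF that True] .
  show ?thesis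
  proof (cases "Sup I \<in> I")
    case True
    then have "t \<in> I \<longleftrightarrow> t \<in> {a..Sup I}" for t
      using below[of t] above[of t] assms(3) by (cases "t = Sup I") auto
    then have "I = {a..Sup I}"
      by (rule set_eqI)
    then show ?thesis
      using that(2) above[OF assms(2)] by blast
  next
    case False
    then have "t \<in> I \<longleftrightarrow> t \<in> {a..<Sup I}" for t
      using below[of t] above[of t] assms(3) by (cases "t = Sup I") auto
    then have "I = {a..<Sup I}"
      by (rule set_eqI)
    then show ?thesis
      using that(3) assms(2) by (metis atLeastLessThan_iff le_less_trans)
  qed
next
  case False
  have "t \<in> I" if "a \<le> t" for t
  proof -
    obtain s where "s \<in> I" "t < s"
      using False unfolding bdd_above_def by (meson not_le)
    then show ?thesis
      using assms that unfolding is_interval_1 by (meson less_imp_le)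
  qed
  then show ?thesis
    using assms(3) that(1) by auto
qed

text \<open>Turns monotonicity into bounds independent of the solution: applied to
  \<open>p0\<close>, \<open>q0 / p0\<close> and \<open>- r0\<close>, it replaces the unknown value
  \<open>w\<close> by 0.\<close>

lemma valley_minimum_at_0:
  fixes g :: "real \<Rightarrow> real"
  assumes "antimono_on {..0} g \<and> mono_on {0..} g"
  shows "g 0 \<le> g w"
  using assms monotone_onD[of "{..0}" "(\<le>)" "(\<ge>)" g w 0] monotone_onD[of "{0..}" "(\<le>)" "(\<le>)" g 0 w]
  by (cases "w \<le> 0") auto

section \<open>Non-extendable solutions are global\<close>

theorem theorem3p6:
  fixes t0 :: real and p0 q0 r0 :: "real \<Rightarrow> real \<Rightarrow> real"
  assumes "continuous_on ({t0..} \<times> UNIV) (\<lambda>(t, w). p0 t w)"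
    and "continuous_on ({t0..} \<times> UNIV) (\<lambda>(t, w). q0 t w)"
    and "continuous_on ({t0..} \<times> UNIV) (\<lambda>(t, w). r0 t w)"
    and "\<And>t w. t \<ge> t0 \<Longrightarrow> p0 t w > 0"
    and "\<And>t w. t \<ge> t0 \<Longrightarrow> r0 t w \<ge> 0"
    and "\<And>t. t \<ge> t0 \<Longrightarrow> antimono_on {..0} (\<lambda>w. p0 t w) \<and> mono_on {0..} (\<lambda>w. p0 t w)"
    and "\<And>t. t \<ge> t0 \<Longrightarrow>
           antimono_on {..0} (\<lambda>w. q0 t w / p0 t w) \<and> mono_on {0..} (\<lambda>w. q0 t w / p0 t w)"
    and "\<And>t. t \<ge> t0 \<Longrightarrow> antimono_on {..0} (\<lambda>w. - r0 t w) \<and> mono_on {0..} (\<lambda>w. - r0 t w)"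
  shows "\<forall>\<phi>0 \<phi>1. ivp_solution_exists_globally t0 p0 q0 r0 \<phi>0 \<phi>1"
proof -
  let ?F = "first_order_rhs p0 q0 r0"
  have F_cont: "continuous_on ({t0..} \<times> UNIV) (\<lambda>(t, z). ?F t z)"
    by (rule continuous_on_first_order_rhs[OF assms(1-3)]) (use assms(4) in simp)
  have F_cont': "continuous_on ({a..b} \<times> UNIV) (\<lambda>(t, z). ?F t z)" if "t0 \<le> a" for a b
    by (rule continuous_on_subset[OF F_cont]) (use that in auto)
  have at_0: "continuous_on {t0..b} (\<lambda>t. g t 0)"
    if "continuous_on ({t0..} \<times> UNIV) (\<lambda>(t, w). g t w)" for b and g :: "real \<Rightarrow> real \<Rightarrow> real"
  proof -
    have "continuous_on {t0..b} (\<lambda>t. (\<lambda>(t, w). g t w) (t, 0))"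
      by (rule continuous_on_compose2[OF that]) (auto intro!: continuous_intros)
    then show ?thesis
      by simp
  qed
  \<comment> \<open>Common end of both bounded cases; \<open>c\<close> itself witnesses that the new
    domain reaches beyond \<open>I\<close>.\<close>
  have extendable: "right_extendable t0 p0 q0 r0 I \<phi>"
    if "I \<subseteq> {t0..c}" "\<And>t. t \<in> I \<Longrightarrow> t < c" "t0 < c"
      and "\<And>t. t \<in> {t0..c} \<Longrightarrow> (z has_vector_derivative ?F t (z t)) (at t within {t0..c})"
      and "\<And>t. t \<in> I \<Longrightarrow> fst (z t) = \<phi> t" for I \<phi> c z
  proof -
    have "\<exists>a\<in>{t0..c}. \<exists>b\<in>{t0..c}. a < b"
      using \<open>t0 < c\<close> by (metis atLeastAtMost_iff less_imp_le order_refl)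
    then have "solution_on t0 p0 q0 r0 {t0..c} (\<lambda>t. fst (z t))"
      by (rule first_order_imp_solution_on[OF _ _ _ F_cont assms(4) that(4), rotated 2])
        (auto simp: is_interval_cc)
    then show ?thesis
      unfolding right_extendable_def using that(1-3,5)
      by (intro exI[of _ "{t0..c}"] exI[of _ "\<lambda>t. fst (z t)"] conjI bexI[of _ c]) auto
  qed
  have "I = {t0..}"
    if sol: "ivp_solution_on t0 p0 q0 r0 c0 c1 I \<phi>" and max: "\<not> right_extendable t0 p0 q0 r0 I \<phi>"
    for c0 c1 I \<phi>
  proof -
    have sol: "solution_on t0 p0 q0 r0 I \<phi>" and "t0 \<in> I"
      using sol by (auto simp: ivp_solution_on_def)
    then have I: "is_interval I" "I \<subseteq> {t0..}" "\<exists>a\<in>I. \<exists>b\<in>I. a < b"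
      by (simp_all add: solution_on_def)
    obtain z where z_\<phi>: "\<And>t. t \<in> I \<Longrightarrow> fst (z t) = \<phi> t"
      and z: "\<And>t. t \<in> I \<Longrightarrow> (z has_vector_derivative ?F t (z t)) (at t within I)"
      using solution_on_imp_first_order[OF sol assms(4)] by blast
    from is_interval_cases_left_closed[OF I(1) \<open>t0 \<in> I\<close> I(2)] show ?thesis
    proof cases
      case 1
      then show ?thesis .
    next
      case (2 b)
      then have "t0 < b"
        using I(3) by auto
      obtain c y where c: "b < c" "y b = z b"
        and y: "\<And>t. t \<in> {b..c} \<Longrightarrow> (y has_vector_derivative ?F t (y t)) (at t within {b..c})"
        by (rule Peano_existence_local[OF F_cont'[OF less_imp_le[OF \<open>t0 < b\<close>]], of "b + 1" "z b"]) auto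
      have "right_extendable t0 p0 q0 r0 I \<phi>"
      proof (rule extendable)
        show "((\<lambda>t. if t \<in> {t0..b} then z t else y t) has_vector_derivative
            ?F t (if t \<in> {t0..b} then z t else y t)) (at t within {t0..c})" if "t \<in> {t0..c}" for t
          by (rule solution_concat) (use 2 z y c that in auto)
      qed (use 2 c z_\<phi> in auto)
      with max show ?thesis
        by blast
    next
      case (3 b)
      have p_nz: "\<forall>t\<in>{t0..b}. p0 t 0 \<noteq> 0"
        using assms(4) by (metis atLeastAtMost_iff less_irrefl)
      have z': "(z has_vector_derivative ?F t (z t)) (at t within {t0..<b})" if "t \<in> {t0..<b}" for t
        using z[of t] 3(1) that by simp
      \<comment> \<open>At \<open>w = 0\<close> the coefficients are continuous functions of time
        alone, hence bounded on the compact interval \<open>{t0..b}\<close>; monotonicity then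
        gives, for every \<open>w\<close>, the one-sided bounds that the energy estimate asks
        for.\<close>
      obtain P where P: "\<And>t. t \<in> {t0..b} \<Longrightarrow> \<bar>1 / p0 t 0\<bar> \<le> P"
        using continuous_on_Icc_bounded[OF continuous_on_divide[OF continuous_on_const at_0[OF assms(1)] p_nz]]
        by blast
      obtain Q where Q: "Q \<ge> 0" "\<And>t. t \<in> {t0..b} \<Longrightarrow> \<bar>q0 t 0 / p0 t 0\<bar> \<le> Q"
        using continuous_on_Icc_bounded[OF continuous_on_divide[OF at_0[OF assms(2)] at_0[OF assms(1)] p_nz]]
        by blast
      obtain R where R: "\<And>t. t \<in> {t0..b} \<Longrightarrow> \<bar>r0 t 0\<bar> \<le> R"
        using continuous_on_Icc_bounded[OF at_0[OF assms(3)]] by blast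
      have bdd: "bounded (z ` {t0..<b})"
      proof (rule first_order_solution_bounded[OF _ _ _ _ Q(1) z'])
        fix t w assume t: "t \<in> {t0..<b}"
        show "0 < p0 t w"
          using assms(4) t by simp
        have "1 / p0 t w \<le> 1 / p0 t 0"
          using valley_minimum_at_0[OF assms(6), of t w] assms(4)[of t 0] t
          by (intro divide_left_mono) auto
        also have "\<dots> \<le> P"
          using abs_le_D1[OF P] t by simp
        finally show "1 / p0 t w \<le> P" .
        show "- Q \<le> q0 t w / p0 t w"
          using valley_minimum_at_0[OF assms(7), of t w] abs_le_D2[OF Q(2), of t] t by simp
        \<comment> \<open>Minimality of \<open>- r0\<close> at 0 is the upper bound
          \<open>r0 t w \<le> r0 t 0\<close>; with \<open>r0 \<ge> 0\<close> it bounds the absolute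
          value.\<close>
        show "\<bar>r0 t w\<bar> \<le> R"
          using valley_minimum_at_0[OF assms(8), of t w] assms(5)[of t w] abs_le_D1[OF R, of t] t
          by simp
      qed
      obtain y where y: "\<And>t. t \<in> {t0..<b} \<Longrightarrow> y t = z t"
        "\<And>t. t \<in> {t0..b} \<Longrightarrow> (y has_vector_derivative ?F t (y t)) (at t within {t0..b})"
        using bounded_solution_extends_to_closed_interval[OF F_cont'[OF order_refl] \<open>t0 < b\<close> z' bdd]
        by blast
      \<comment> \<open>The closed interval \<open>{t0..b}\<close> is itself the extension:
        \<open>b\<close> lies beyond every point of \<open>{t0..<b}\<close>, so reaching it already
        contradicts maximality.\<close>
      have "right_extendable t0 p0 q0 r0 I \<phi>"
        by (rule extendable[OF _ _ _ y(2)]) (use 3 y(1) z_\<phi> in auto)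
      with max show ?thesis
        by blast
    qed
  qed
  then show ?thesis
    by (simp add: ivp_solution_exists_globally_def)
qed

end
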